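(* For every value of the condition number $\kappa\ge 1$ there exist positive constants $c_1,c_2$, depending only on $\kappa$, such that for all $0<\mu\le L$ with $L/\mu=\kappa$, every $f\in\mathcal{S}_{\mu,L}$ with minimizer $x^\star$ and $f^\star=f(x^\star)$, every $x_0\in\mathbb{R}^n$, and every $t\ge 0$, the speed-restarted solution $X^{\mathrm{sr}}$ started at $x_0$ satisfies $$f(X^{\mathrm{sr}}(t))-f^\star\le\frac{c_1L\|x_0-x^\star\|^2}{2}\,e^{-c_2t\sqrt{L}} .$$
   Context: $\|\cdot\|$ is the Euclidean norm on $\mathbb{R}^n$. For $0<\mu\le L$, $\mathcal{S}_{\mu,L}$ is the class of continuously differentiable $f:\mathbb{R}^n\to\mathbb{R}$ such that $f(x)-\mu\|x\|^2/2$ is convex and $\|\nabla f(x)-\nabla f(y)\|\le L\|x-y\|$ for all $x,y$. For $f\in\mathcal{S}_{\mu,L}$ and $z\in\mathbb{R}^n$ let $X(\cdot\,;z)\in C^2((0,\infty);\mathbb{R}^n)\cap C^1([0,\infty);\mathbb{R}^n)$ be the unique solution of $$\ddot X(t)+\frac{3}{t}\dot X(t)+\nabla f(X(t))=0\ (t>0),\qquad X(0)=z,\ \dot X(0)=0 .$$ For $z\ne x^\star$ the speed restarting time is $$T(z;f)=\sup\left\{t>0:\ \forall u\in(0,t),\ \frac{\mathrm{d}\|\dot X(u;z)\|^2}{\mathrm{d}u}>0\right\}.$$ It satisfies $4/(5\sqrt L)\le T(z;f)<\infty$. The speed-restarted solution $X^{\mathrm{sr}}:[0,\infty)\to\mathbb{R}^n$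 started at $x_0$ follows the ODE above and restarts it, with time and velocity reset to $0$, each time the speed restarting time is reached. Precisely: $X^{\mathrm{sr}}$ is continuous with $X^{\mathrm{sr}}(0)=x_0$; $T_1=T(x_0;f)$ and $X^{\mathrm{sr}}(t)=X(t;x_0)$ for $0\le t\le T_1$; and recursively for $i\ge1$, with $\tau_i=\sum_{j=1}^iT_j$, one sets $T_{i+1}=T(X^{\mathrm{sr}}(\tau_i);f)$ and $X^{\mathrm{sr}}(\tau_i+t)=X(t;X^{\mathrm{sr}}(\tau_i))$ for $0\le t\le T_{i+1}$. In the trivial case where the starting point (of the whole process or of a restart) equals $x^\star$, $X^{\mathrm{sr}}$ stays constantly equal to $x^\star$ from then on. *)

theory Defs
  imports "HOL-Analysis.Analysis"
begin

text \<open>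
  The constants in the theorem must not depend on the dimension \<open>n\<close>, so \<open>n\<close> has to be
  quantified inside the formula and cannot be a type parameter. We therefore use one inner
  product space, the finitely supported real sequences, and represent \<open>\<real>\<^sup>n\<close> by the subspace
  \<open>Rn n\<close> of the sequences supported on \<open>{..<n}\<close>. Functions on \<open>\<real>\<^sup>n\<close> are functions on the
  whole type of which only the values on \<open>Rn n\<close> matter; accordingly derivatives are taken
  within \<open>Rn n\<close>.
\<close>

typedef fseq = "{x :: nat \<Rightarrow> real. finite {i. x i \<noteq> 0}}"
  morphisms coord Abs_fseq
  by (rule exI[of _ "\<lambda>_. 0"]) simp

setup_lifting type_definition_fseq

lemma finite_support: "finite {i. coord x i \<noteq> 0}"
  using coord[of x] by simp

lemma fseq_eqI: "(\<And>i. coord x i = coord y i) \<Longrightarrow> x = y"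
  by (simp add: coord_inject[symmetric] fun_eq_iff)

instantiation fseq :: real_vector
begin

lift_definition zero_fseq :: fseq is "\<lambda>_. 0" by simp

lift_definition plus_fseq :: "fseq \<Rightarrow> fseq \<Rightarrow> fseq" is "\<lambda>x y i. x i + y i"
proof -
  fix x y :: "nat \<Rightarrow> real"
  assume "finite {i. x i \<noteq> 0}" "finite {i. y i \<noteq> 0}"
  then show "finite {i. x i + y i \<noteq> 0}"
    by (rule finite_subset[OF _ finite_UnI, rotated]) auto
qed

lift_definition uminus_fseq :: "fseq \<Rightarrow> fseq" is "\<lambda>x i. - x i" by simp

lift_definition minus_fseq :: "fseq \<Rightarrow> fseq \<Rightarrow> fseq" is "\<lambda>x y i. x i - y i"
proof -
  fix x y :: "nat \<Rightarrow> real"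
  assume "finite {i. x i \<noteq> 0}" "finite {i. y i \<noteq> 0}"
  then show "finite {i. x i - y i \<noteq> 0}"
    by (rule finite_subset[OF _ finite_UnI, rotated]) auto
qed

lift_definition scaleR_fseq :: "real \<Rightarrow> fseq \<Rightarrow> fseq" is "\<lambda>r x i. r * x i"
proof -
  fix r and x :: "nat \<Rightarrow> real"
  assume "finite {i. x i \<noteq> 0}"
  then show "finite {i. r * x i \<noteq> 0}" by (rule finite_subset[rotated]) auto
qed

instance
  by standard (transfer; auto simp: fun_eq_iff algebra_simps)+

end

lemma coord_simps [simp]:
  "coord 0 i = 0"
  "coord (x + y) i = coord x i + coord y i"
  "coord (- x) i = - coord x i"
  "coord (x - y) i = coord x i - coord y i"
  "coord (r *\<^sub>R x) i = r * coord x i"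
  by (transfer; simp)+

instantiation fseq :: real_inner
begin

definition inner_fseq :: "fseq \<Rightarrow> fseq \<Rightarrow> real" where
  "inner_fseq x y = (\<Sum>i | coord x i \<noteq> 0. coord x i * coord y i)"

definition norm_fseq :: "fseq \<Rightarrow> real" where
  "norm_fseq x = sqrt (inner x x)"

definition dist_fseq :: "fseq \<Rightarrow> fseq \<Rightarrow> real" where
  "dist_fseq x y = norm (x - y)"

definition sgn_fseq :: "fseq \<Rightarrow> fseq" where
  "sgn_fseq x = inverse (norm x) *\<^sub>R x"

definition uniformity_fseq :: "(fseq \<times> fseq) filter" where
  "uniformity_fseq = (INF e\<in>{0<..}. principal {(x, y). dist x y < e})"

definition open_fseq :: "fseq set \<Rightarrow> bool" where
  "open_fseq U \<longleftrightarrow> (\<forall>x\<in>U. \<forall>\<^sub>F (x', y) in uniformity. x' = x \<longrightarrow> y \<in> U)"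

lemma inner_fseq_superset:
  assumes "finite S" "{i. coord x i \<noteq> 0} \<subseteq> S"
  shows "inner x y = (\<Sum>i\<in>S. coord x i * coord y i)"
  unfolding inner_fseq_def by (rule sum.mono_neutral_left) (use assms in auto)

instance
proof
  fix x y z :: fseq and r :: real
  let ?S = "{i. coord x i \<noteq> 0} \<union> {i. coord y i \<noteq> 0}"
  have S: "finite ?S" using finite_support by blast
  note [simp] = dist_fseq_def sgn_fseq_def norm_fseq_def
  show "dist x y = norm (x - y)" "sgn x = x /\<^sub>R norm x" "norm x = sqrt (inner x x)" by simp_all
  show "uniformity = (INF e\<in>{0<..}. principal {(x::fseq, y). dist x y < e})"
    by (rule uniformity_fseq_def)
  show "open U \<longleftrightarrow> (\<forall>x\<in>U. \<forall>\<^sub>F (x', y) in uniformity. x' = x \<longrightarrow> y \<in> U)" for U :: "fseq set"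
    by (rule open_fseq_def)
  show "inner x y = inner y x"
    using inner_fseq_superset[OF S, of x y] inner_fseq_superset[OF S, of y x]
    by (simp add: mult.commute)
  have "inner (x + y) z = (\<Sum>i\<in>?S. coord (x + y) i * coord z i)"
    by (rule inner_fseq_superset[OF S]) auto
  also have "\<dots> = inner x z + inner y z"
    using inner_fseq_superset[OF S, of x z] inner_fseq_superset[OF S, of y z]
    by (simp add: distrib_right sum.distrib)
  finally show "inner (x + y) z = inner x z + inner y z" .
  have "inner (r *\<^sub>R x) y = (\<Sum>i\<in>?S. coord (r *\<^sub>R x) i * coord y i)"
    by (rule inner_fseq_superset[OF S]) auto
  also have "\<dots> = r * inner x y"
    using inner_fseq_superset[OF S, of x y] by (simp add: sum_distrib_left mult.assoc)
  finally show "inner (r *\<^sub>R x) y = r * inner x y" .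
  show "0 \<le> inner x x"
    unfolding inner_fseq_def by (simp add: sum_nonneg)
  have "inner x x = 0 \<longleftrightarrow> (\<forall>i\<in>{i. coord x i \<noteq> 0}. coord x i * coord x i = 0)"
    unfolding inner_fseq_def by (rule sum_nonneg_eq_0_iff) (simp_all add: finite_support)
  also have "\<dots> \<longleftrightarrow> x = 0"
    by (auto intro: fseq_eqI)
  finally show "inner x x = 0 \<longleftrightarrow> x = 0" .
qed

end

definition Rn :: "nat \<Rightarrow> fseq set" where
  "Rn n = {x. \<forall>i\<ge>n. coord x i = 0}"

lemma subspace_Rn: "subspace (Rn n)"
  by (auto simp: subspace_def Rn_def)

lemma inner_Rn: "x \<in> Rn n \<Longrightarrow> inner x y = (\<Sum>i<n. coord x i * coord y i)"
  by (rule inner_fseq_superset) (auto simp: Rn_def intro: not_le_imp_less)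

lemma norm_Rn: "x \<in> Rn n \<Longrightarrow> norm x = L2_set (coord x) {..<n}"
  by (simp add: norm_eq_sqrt_inner inner_Rn L2_set_def power2_eq_square)

lemma Rn_coordinates: "\<exists>!x. x \<in> Rn n \<and> (\<forall>i<n. coord x i = v i)"
proof
  let ?x = "Abs_fseq (\<lambda>i. if i < n then v i else 0)"
  have "finite {i. (if i < n then v i else 0) \<noteq> 0}"
    by (rule finite_subset[of _ "{..<n}"]) (auto split: if_splits)
  then have coord: "coord ?x i = (if i < n then v i else 0)" for i
    by (simp add: Abs_fseq_inverse)
  then show "?x \<in> Rn n \<and> (\<forall>i<n. coord ?x i = v i)"
    by (simp add: Rn_def)
  show "x = ?x" if x: "x \<in> Rn n \<and> (\<forall>i<n. coord x i = v i)" for x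
  proof (rule fseq_eqI)
    show "coord x i = coord ?x i" for i
      using x by (cases "i < n") (simp_all add: coord Rn_def)
  qed
qed

definition gradient :: "nat \<Rightarrow> (fseq \<Rightarrow> real) \<Rightarrow> fseq \<Rightarrow> fseq" where
  "gradient n f x =
    (THE g. g \<in> Rn n \<and> (f has_derivative (\<lambda>h. inner g h)) (at x within Rn n))"

definition S_class :: "nat \<Rightarrow> real \<Rightarrow> real \<Rightarrow> (fseq \<Rightarrow> real) set" where
  "S_class n \<mu> L = {f.
     f differentiable_on Rn n \<and>
     continuous_on (Rn n) (gradient n f) \<and>
     convex_on (Rn n) (\<lambda>x. f x - \<mu> * (norm x)\<^sup>2 / 2) \<and>
     (\<forall>x\<in>Rn n. \<forall>y\<in>Rn n. norm (gradient n f x - gradient n f y) \<le> L * norm (x - y))}"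

text \<open>The functions \<open>V\<close> and \<open>A\<close> are the velocity and the acceleration of \<open>X\<close>.\<close>

definition ode_solution :: "nat \<Rightarrow> (fseq \<Rightarrow> real) \<Rightarrow> fseq \<Rightarrow> (real \<Rightarrow> fseq) \<Rightarrow> bool" where
  "ode_solution n f z X \<longleftrightarrow>
     (\<forall>t\<ge>0. X t \<in> Rn n) \<and> X 0 = z \<and>
     (\<exists>V A.
        (\<forall>t\<ge>0. (X has_vector_derivative V t) (at t within {0..})) \<and>
        continuous_on {0..} V \<and> V 0 = 0 \<and>
        (\<forall>t>0. (V has_vector_derivative A t) (at t)) \<and>
        continuous_on {0<..} A \<and>
        (\<forall>t>0. A t + (3 / t) *\<^sub>R V t + gradient n f (X t) = 0))"

text \<open>
  The restarting time is a functional of the trajectory \<open>X = X(\<cdot>; z)\<close>. The supremum is taken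
  in \<open>real\<close>, so it is meaningful because the set is nonempty and bounded above whenever \<open>X\<close>
  solves the equation for some \<open>f\<close> in the class and \<open>z\<close> is not the minimizer.
\<close>

definition restart_time :: "(real \<Rightarrow> fseq) \<Rightarrow> real" where
  "restart_time X =
     Sup {t. t > 0 \<and> (\<forall>u\<in>{0<..<t}. deriv (\<lambda>s. (norm (vector_derivative X (at s)))\<^sup>2) u > 0)}"

text \<open>
  \<open>T i\<close> for \<open>i \<ge> 1\<close> is the length of the \<open>i\<close>-th run. Once a run starts at the minimizer \<open>xs\<close>
  there are no further restarts, and the remaining lengths are set to 0 by convention.
\<close>

definition speed_restarted ::
    "nat \<Rightarrow> (fseq \<Rightarrow> real) \<Rightarrow> fseq \<Rightarrow> fseq \<Rightarrow> (real \<Rightarrow> fseq) \<Rightarrow> bool" where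
  "speed_restarted n f xs x0 X \<longleftrightarrow>
     (\<forall>t\<ge>0. X t \<in> Rn n) \<and> continuous_on {0..} X \<and> X 0 = x0 \<and>
     (\<exists>T :: nat \<Rightarrow> real. \<forall>i. let \<tau> = (\<Sum>j=1..i. T j) in
        if X \<tau> = xs then T (Suc i) = 0 \<and> (\<forall>t\<ge>\<tau>. X t = xs)
        else \<exists>Y. ode_solution n f (X \<tau>) Y \<and>
                 T (Suc i) = restart_time Y \<and>
                 (\<forall>t\<in>{0..T (Suc i)}. X (\<tau> + t) = Y t))"

text \<open>Sanity check: the definite description in \<open>gradient\<close> is well defined.\<close>

lemma gradient_eqI:
  assumes x: "x \<in> Rn n" and g: "g \<in> Rn n"
    and der: "(f has_derivative (\<lambda>h. inner g h)) (at x within Rn n)"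
  shows "gradient n f x = g"
  unfolding gradient_def
proof (rule the_equality)
  show "g \<in> Rn n \<and> (f has_derivative (\<lambda>h. inner g h)) (at x within Rn n)"
    using g der by simp
next
  fix g' assume g': "g' \<in> Rn n \<and> (f has_derivative (\<lambda>h. inner g' h)) (at x within Rn n)"
  define d where "d = g' - g"
  have line: "x + s *\<^sub>R d \<in> Rn n" for s
    using x g g' by (auto simp: d_def Rn_def)
  have *: "((\<lambda>s. f (x + s *\<^sub>R d)) has_derivative (\<lambda>s. inner a (s *\<^sub>R d))) (at 0)"
    if "(f has_derivative (\<lambda>h. inner a h)) (at x within Rn n)" for a
  proof -
    have 1: "((\<lambda>s. x + s *\<^sub>R d) has_derivative (\<lambda>s. s *\<^sub>R d)) (at (0::real))"
      by (auto intro!: derivative_eq_intros)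
    have 2: "(f has_derivative (\<lambda>h. inner a h))
        (at (x + 0 *\<^sub>R d) within range (\<lambda>s. x + s *\<^sub>R d))"
      using has_derivative_subset[OF that, of "range (\<lambda>s. x + s *\<^sub>R d)"] line by auto
    show ?thesis
      using has_derivative_in_compose[OF 1 2] by simp
  qed
  have "(\<lambda>s. inner g (s *\<^sub>R d)) = (\<lambda>s. inner g' (s *\<^sub>R d))"
    using has_derivative_unique[OF *[OF der] *] g' by blast
  from fun_cong[OF this, of 1] have "inner d d = 0"
    by (simp add: d_def inner_diff_left)
  then show "g' = g" by (simp add: d_def)
qed

lemma has_derivative_gradient:
  assumes x: "x \<in> Rn n" and diff: "f differentiable (at x within Rn n)"
  shows "gradient n f x \<in> Rn n"
    and "(f has_derivative (\<lambda>h. inner (gradient n f x) h)) (at x within Rn n)"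
proof -
  obtain D where D: "(f has_derivative D) (at x within Rn n)"
    using diff by (auto simp: differentiable_def)
  then interpret D: bounded_linear D by (rule has_derivative_bounded_linear)
  define e where "e j = Abs_fseq (\<lambda>i. if i = j then 1 else 0)" for j
  have e: "coord (e j) i = (if i = j then 1 else 0)" for i j
    by (simp add: e_def Abs_fseq_inverse)
  have coord_sum: "coord (\<Sum>j<n. c j *\<^sub>R e j) i = (if i < n then c i else 0)" for c i
  proof -
    have "coord (\<Sum>j<m. c j *\<^sub>R e j) i = (if i < m then c i else 0)" for m
      by (induction m) (auto simp: e less_Suc_eq)
    then show ?thesis .
  qed
  define g where "g = (\<Sum>j<n. D (e j) *\<^sub>R e j)"
  have g: "g \<in> Rn n" by (simp add: g_def Rn_def coord_sum)
  have D_eq: "D h = inner g h" if "h \<in> Rn n" for h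
  proof -
    have "h = (\<Sum>j<n. coord h j *\<^sub>R e j)"
      using that by (intro fseq_eqI) (auto simp: coord_sum Rn_def)
    then have "D h = D (\<Sum>j<n. coord h j *\<^sub>R e j)"
      by (rule arg_cong)
    also have "\<dots> = (\<Sum>j<n. coord h j * D (e j))"
      by (simp add: D.sum D.scaleR)
    also have "\<dots> = inner g h"
      unfolding inner_Rn[OF g] by (rule sum.cong) (auto simp: g_def coord_sum)
    finally show ?thesis .
  qed
  have "(f has_derivative (\<lambda>h. inner g h)) (at x within Rn n)"
    unfolding has_derivative_within
  proof (intro conjI bounded_linear_inner_right)
    have "((\<lambda>y. (1 / norm (y - x)) *\<^sub>R (f y - (f x + D (y - x)))) \<longlongrightarrow> 0) (at x within Rn n)"
      using D by (simp add: has_derivative_within)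
    moreover have "\<forall>\<^sub>F y in at x within Rn n. (1 / norm (y - x)) *\<^sub>R (f y - (f x + D (y - x))) =
        (1 / norm (y - x)) *\<^sub>R (f y - (f x + inner g (y - x)))"
      by (auto simp: eventually_at_filter D_eq subspace_diff[OF subspace_Rn _ x])
    ultimately show "((\<lambda>y. (1 / norm (y - x)) *\<^sub>R (f y - (f x + inner g (y - x)))) \<longlongrightarrow> 0)
        (at x within Rn n)"
      by (rule Lim_transform_eventually)
  qed
  moreover from this have "gradient n f x = g" by (rule gradient_eqI[OF x g])
  ultimately show "gradient n f x \<in> Rn n"
    "(f has_derivative (\<lambda>h. inner (gradient n f x) h)) (at x within Rn n)"
    using g by simp_all
qed

end

theory Submission
  imports Defs
begin

text \<open>
  Let \<open>z \<noteq> x\<^sup>\<star>\<close> be the starting point of a run, \<open>g = \<parallel>\<nabla>f(z)\<parallel>\<close> and \<open>a = L / \<surd>\<mu>\<close>. Since the energy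
  \<open>f(X) + \<parallel>X'\<parallel>\<^sup>2 / 2\<close> decreases and \<open>f(z) - f\<^sup>\<star> \<le> g\<^sup>2 / (2\<mu>)\<close>, the speed is at most \<open>g / \<surd>\<mu>\<close>, so
  \<open>\<nabla>f(X(t))\<close> is within \<open>a g t\<close> of \<open>\<nabla>f(z)\<close> and \<open>X'(t)\<close> is within \<open>a g t\<^sup>2 / 5\<close> of
  \<open>- t \<nabla>f(z) / 4\<close>. Hence up to the time \<open>t\<^sub>0 = 1 / (10 a)\<close> the speed increases and is at least
  \<open>t g / 8\<close>. While the speed increases, \<open>f(X)\<close> decreases at rate at least \<open>3 \<parallel>X'\<parallel>\<^sup>2 / t\<close>. On
  \<open>[0, t\<^sub>0]\<close> this gives a decrease of at least a fixed fraction of \<open>f(z) - f\<^sup>\<star>\<close>; after \<open>t\<^sub>0\<close> it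
  gives logarithmic growth of the decrease, which is bounded by \<open>g\<^sup>2 / (2\<mu>)\<close>, and so bounds the
  restarting time. In units of \<open>1 / \<surd>L\<close> all constants depend only on \<open>\<kappa>\<close>, and iterating over the
  runs gives the exponential rate.
\<close>

lemma has_real_derivative_norm_square:
  fixes V :: "real \<Rightarrow> 'a::real_inner"
  assumes "(V has_vector_derivative v) (at t)"
  shows "((\<lambda>u. (norm (V u))\<^sup>2) has_real_derivative 2 * inner (V t) v) (at t)"
proof -
  have "(V has_derivative (\<lambda>h. h *\<^sub>R v)) (at t)"
    using assms by (simp add: has_vector_derivative_def)
  from has_derivative_inner[OF this this] show ?thesis
    by (simp add: has_field_derivative_def power2_norm_eq_inner inner_commute
        mult_commute_abs algebra_simps)
qed

section \<open>Consequences of strong convexity and of the Lipschitz gradient\<close>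

locale strongly_convex_smooth =
  fixes n :: nat and \<mu> L :: real and f :: "fseq \<Rightarrow> real" and xs :: fseq
  assumes mu_pos: "0 < \<mu>" and mu_le_L: "\<mu> \<le> L"
    and S_class: "f \<in> S_class n \<mu> L"
    and minimizer: "is_arg_min f (\<lambda>x. x \<in> Rn n) xs"
begin

abbreviation grad :: "fseq \<Rightarrow> fseq" where
  "grad \<equiv> gradient n f"

definition a :: real where "a = L / sqrt \<mu>"

definition t0 :: real where "t0 = 1 / (10 * a)"

text \<open>With \<open>g\<close> the gradient norm at the start of a run, the exponent is
  \<open>g\<^sup>2 / (2 * \<mu>)\<close>, which bounds the total decrease of \<open>f\<close>,
  divided by \<open>3 * (t0 * g / 8)\<^sup>2\<close>, the rate of its logarithmic growth after
  \<open>t0\<close>. The factor \<open>g\<close> cancels.\<close>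

definition T_max :: real where "T_max = t0 * exp (3200 / 3 * (L / \<mu>)\<^sup>2)"

lemma L_pos: "0 < L"
  using mu_pos mu_le_L by simp

lemma a_pos: "0 < a" and t0_pos: "0 < t0" and T_max_pos: "0 < T_max"
  using L_pos mu_pos by (simp_all add: a_def t0_def T_max_def)

lemma xs_in: "xs \<in> Rn n"
  using minimizer by (simp add: is_arg_min_def)

lemma f_min: "x \<in> Rn n \<Longrightarrow> f xs \<le> f x"
  using minimizer by (auto simp: is_arg_min_def not_less)

lemma grad_in: "x \<in> Rn n \<Longrightarrow> grad x \<in> Rn n"
  and has_derivative_grad:
    "x \<in> Rn n \<Longrightarrow> (f has_derivative (\<lambda>h. inner (grad x) h)) (at x within Rn n)"
  using S_class has_derivative_gradient unfolding S_class_def differentiable_on_def by blast+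

lemma grad_lipschitz:
  "x \<in> Rn n \<Longrightarrow> y \<in> Rn n \<Longrightarrow> norm (grad x - grad y) \<le> L * norm (x - y)"
  using S_class by (simp add: S_class_def)

text \<open>The derivative of \<open>f\<close> is available only within \<open>Rn n\<close>, so the
  chain rule goes through the image of \<open>S\<close> under the curve, which stays in that
  subspace.\<close>

lemma f_along_curve:
  assumes X: "(X has_vector_derivative v) (at s within S)"
    and "s \<in> S" "\<And>u. u \<in> S \<Longrightarrow> X u \<in> Rn n"
  shows "((\<lambda>u. f (X u)) has_real_derivative inner (grad (X s)) v) (at s within S)"
proof -
  have "(f has_derivative (\<lambda>h. inner (grad (X s)) h)) (at (X s) within X ` S)"
    by (rule has_derivative_subset[OF has_derivative_grad]) (use assms in auto)
  from has_derivative_in_compose[OF X[unfolded has_vector_derivative_def] this]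
  show ?thesis
    by (simp add: has_field_derivative_def mult_commute_abs)
qed

lemma line_in: "x \<in> Rn n \<Longrightarrow> y \<in> Rn n \<Longrightarrow> x + s *\<^sub>R (y - x) \<in> Rn n"
  by (intro subspace_add subspace_scale subspace_diff subspace_Rn)

lemma f_along_line:
  assumes "x \<in> Rn n" "y \<in> Rn n"
  shows "((\<lambda>s. f (x + s *\<^sub>R (y - x))) has_real_derivative inner (grad x) (y - x)) (at 0)"
proof -
  have "((\<lambda>s. x + s *\<^sub>R (y - x)) has_vector_derivative (y - x)) (at 0)"
    by (auto intro!: derivative_eq_intros)
  from f_along_curve[OF this] show ?thesis
    using line_in[OF assms] by simp
qed

text \<open>On the line through \<open>x\<close> and \<open>y\<close> the convex function
  \<open>h\<close> becomes a convex function of one real variable, which lies above its tangent at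
  0. At 1 the quadratic terms combine to \<open>(norm (y - x))\<^sup>2\<close>.\<close>

lemma strong_convexity:
  assumes x: "x \<in> Rn n" and y: "y \<in> Rn n"
  shows "f y \<ge> f x + inner (grad x) (y - x) + \<mu> / 2 * (norm (y - x))\<^sup>2"
proof -
  define h where "h = (\<lambda>z. f z - \<mu> * (norm z)\<^sup>2 / 2)"
  define l where "l s = x + s *\<^sub>R (y - x)" for s :: real
  have h: "convex_on (Rn n) h"
    using S_class by (simp add: S_class_def h_def)
  have convex: "convex_on UNIV (\<lambda>s. h (l s))"
  proof (rule convex_onI)
    fix t a b :: real assume t: "0 < t" "t < 1"
    have "l ((1 - t) *\<^sub>R a + t *\<^sub>R b) = (1 - t) *\<^sub>R l a + t *\<^sub>R l b"
      by (simp add: l_def algebra_simps)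
    then show "h (l ((1 - t) *\<^sub>R a + t *\<^sub>R b)) \<le> (1 - t) * h (l a) + t * h (l b)"
      using convex_onD[OF h, of t "l a" "l b"] t line_in[OF x y] by (simp add: l_def)
  qed simp
  have "(l has_vector_derivative (y - x)) (at 0)"
    unfolding l_def by (auto intro!: derivative_eq_intros)
  from has_real_derivative_norm_square[OF this]
  have "((\<lambda>s. (norm (l s))\<^sup>2) has_real_derivative 2 * inner x (y - x)) (at 0)"
    by (simp add: l_def)
  from DERIV_diff[OF f_along_line[OF x y] DERIV_cdivide[OF DERIV_cmult[OF this, of \<mu>], of 2]]
  have "((\<lambda>s. h (l s)) has_real_derivative inner (grad x) (y - x) - \<mu> * inner x (y - x)) (at 0)"
    by (simp add: h_def l_def)
  then have "h (l 1) - h (l 0) \<ge> (inner (grad x) (y - x) - \<mu> * inner x (y - x)) * (1 - 0)"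
    by (intro convex_on_imp_above_tangent[OF convex]) auto
  then show ?thesis
    by (simp add: h_def l_def power2_norm_eq_inner inner_diff_left inner_diff_right
        inner_commute[of y x] algebra_simps)
qed

text \<open>In the direction of \<open>grad xs\<close> itself, which stays in \<open>Rn n\<close>,
  the derivative of \<open>f\<close> at the minimizer is the squared norm of the gradient.\<close>

lemma grad_minimizer: "grad xs = 0"
proof -
  define y where "y = xs + grad xs"
  have y: "y \<in> Rn n"
    unfolding y_def by (intro subspace_add subspace_Rn xs_in grad_in)
  have "inner (grad xs) (y - xs) = 0"
    by (rule DERIV_local_min[OF f_along_line[OF xs_in y], of 1])
      (simp_all add: f_min line_in xs_in y)
  then show ?thesis by (simp add: y_def)
qed

text \<open>This is the Polyak-Lojasiewicz inequality. Strong convexity bounds the gap by a concave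
  quadratic in the distance \<open>d\<close>, and completing the square gives its maximum.\<close>

lemma gap_le_norm_grad:
  assumes "x \<in> Rn n"
  shows "f x - f xs \<le> (norm (grad x))\<^sup>2 / (2 * \<mu>)"
proof -
  define g d where "g = norm (grad x)" and "d = norm (xs - x)"
  have "- (g * d) \<le> inner (grad x) (xs - x)"
    using Cauchy_Schwarz_ineq2[of "grad x" "xs - x"] by (simp add: g_def d_def)
  then have "f x - f xs \<le> g * d - \<mu> / 2 * d\<^sup>2"
    using strong_convexity[OF assms xs_in] by (simp add: d_def)
  also have "\<dots> = g\<^sup>2 / (2 * \<mu>) - (g - \<mu> * d)\<^sup>2 / (2 * \<mu>)"
    using mu_pos by (simp add: field_simps power2_eq_square)
  also have "\<dots> \<le> g\<^sup>2 / (2 * \<mu>)"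
    using mu_pos by simp
  finally show ?thesis by (simp add: g_def)
qed

lemma gap_le_dist:
  assumes x: "x \<in> Rn n"
  shows "f x - f xs \<le> L * (norm (x - xs))\<^sup>2"
proof -
  have "0 \<le> \<mu> / 2 * (norm (xs - x))\<^sup>2"
    using mu_pos by simp
  then have "f x - f xs \<le> inner (grad x) (x - xs)"
    using strong_convexity[OF x xs_in] by (simp add: inner_diff_right)
  also have "\<dots> \<le> norm (grad x) * norm (x - xs)"
    by (rule norm_cauchy_schwarz)
  also have "\<dots> \<le> (L * norm (x - xs)) * norm (x - xs)"
    using grad_lipschitz[OF x xs_in] by (intro mult_right_mono) (simp_all add: grad_minimizer)
  finally show ?thesis by (simp add: power2_eq_square)
qed

lemma grad_nonzero:
  assumes x: "x \<in> Rn n" and "x \<noteq> xs"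
  shows "0 < norm (grad x)"
proof -
  have "grad x \<noteq> 0"
  proof
    assume "grad x = 0"
    then have "f x + \<mu> / 2 * (norm (xs - x))\<^sup>2 \<le> f xs"
      using strong_convexity[OF x xs_in] by simp
    moreover have "0 < \<mu> / 2 * (norm (xs - x))\<^sup>2"
      using mu_pos \<open>x \<noteq> xs\<close> by simp
    ultimately show False using f_min[OF x] by simp
  qed
  then show ?thesis by simp
qed

end

section \<open>A single run of the differential equation\<close>

locale restarted_run = strongly_convex_smooth +
  fixes z :: fseq and X V A :: "real \<Rightarrow> fseq"
  assumes z_ne: "z \<noteq> xs"
    and X_in: "\<And>t. t \<ge> 0 \<Longrightarrow> X t \<in> Rn n"
    and X_0: "X 0 = z"
    and X_deriv_0: "\<And>t. t \<ge> 0 \<Longrightarrow> (X has_vector_derivative V t) (at t within {0..})"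
    and V_cont: "continuous_on {0..} V"
    and V_0: "V 0 = 0"
    and V_deriv: "\<And>t. t > 0 \<Longrightarrow> (V has_vector_derivative A t) (at t)"
    and ode: "\<And>t. t > 0 \<Longrightarrow> A t + (3 / t) *\<^sub>R V t + grad (X t) = 0"
begin

definition g :: real where "g = norm (grad z)"

lemma z_in: "z \<in> Rn n"
  using X_in[of 0] X_0 by simp

lemma g_pos: "g > 0"
  using grad_nonzero[OF z_in z_ne] by (simp add: g_def)

lemma A_eq: "t > 0 \<Longrightarrow> A t = - (3 / t) *\<^sub>R V t - grad (X t)"
  using ode[of t] by (simp add: algebra_simps eq_neg_iff_add_eq_0)

lemma X_deriv: "t > 0 \<Longrightarrow> (X has_vector_derivative V t) (at t)"
  using X_deriv_0[of t] by (simp add: at_within_interior[of t "{0..}"])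

lemma X_cont: "continuous_on {0..} X"
  using X_deriv_0 by (auto simp: continuous_on_eq_continuous_within
      intro: has_vector_derivative_continuous)

lemma f_X_cont: "continuous_on {0..} (\<lambda>t. f (X t))"
  unfolding continuous_on_eq_continuous_within
proof
  fix t :: real assume "t \<in> {0..}"
  then have "((\<lambda>u. f (X u)) has_real_derivative inner (grad (X t)) (V t)) (at t within {0..})"
    by (intro f_along_curve X_deriv_0) (auto simp: X_in)
  then show "continuous (at t within {0..}) (\<lambda>u. f (X u))"
    by (rule DERIV_continuous)
qed

lemma speed_deriv:
  assumes "t > 0"
  shows "((\<lambda>u. (norm (V u))\<^sup>2) has_real_derivative 2 * inner (V t) (A t)) (at t)"
  by (rule has_real_derivative_norm_square[OF V_deriv[OF assms]])

text \<open>The equation replaces the gradient in the chain rule by velocity and acceleration, so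
  that \<open>inner (V t) (A t)\<close>, half the derivative of the squared speed, appears. Where it
  is positive, \<open>f\<close> decreases along the run.\<close>

lemma f_X_deriv:
  assumes "t > 0"
  shows "((\<lambda>u. f (X u)) has_real_derivative
    - inner (V t) (A t) - 3 / t * (norm (V t))\<^sup>2) (at t)"
proof -
  have "((\<lambda>u. f (X u)) has_real_derivative inner (grad (X t)) (V t)) (at t within {0<..})"
    using X_deriv[OF assms] assms
    by (intro f_along_curve) (auto simp: X_in intro: has_vector_derivative_at_within)
  moreover have "inner (grad (X t)) (V t) = - inner (V t) (A t) - 3 / t * (norm (V t))\<^sup>2"
    by (simp add: A_eq[OF assms] inner_diff_right inner_commute power2_norm_eq_inner)
  ultimately show ?thesis
    using assms by (simp add: at_within_open[of t "{0<..}"])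
qed

lemma f_X_antimono:
  assumes "0 \<le> s" "s \<le> t" and "\<And>u. s < u \<Longrightarrow> u < t \<Longrightarrow> inner (V u) (A u) > 0"
  shows "f (X t) \<le> f (X s)"
proof (rule DERIV_nonpos_imp_decreasing_open[OF assms(2)])
  fix u assume u: "s < u" "u < t"
  then have "0 < u" using assms by simp
  moreover from this have "0 \<le> 3 / u * (norm (V u))\<^sup>2"
    by simp
  then have "- inner (V u) (A u) - 3 / u * (norm (V u))\<^sup>2 \<le> 0"
    using assms(3)[OF u] by linarith
  ultimately show "\<exists>y. ((\<lambda>u. f (X u)) has_real_derivative y) (at u) \<and> y \<le> 0"
    using f_X_deriv by blast
qed (use assms continuous_on_subset[OF f_X_cont] in auto)

lemma velocity_bound:
  assumes "t \<ge> 0"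
  shows "norm (V t) \<le> g / sqrt \<mu>"
proof -
  \<comment> \<open>In the derivative of this energy the terms with \<open>inner (V u) (A u)\<close>
    cancel and only the friction \<open>- 3 / u * (norm (V u))\<^sup>2\<close> remains. At time 0 it
    equals \<open>f z\<close> because \<open>V 0 = 0\<close>.\<close>
  define E where "E u = f (X u) + (norm (V u))\<^sup>2 / 2" for u
  have "E t \<le> E 0"
  proof (rule DERIV_nonpos_imp_decreasing_open[OF assms])
    fix u assume u: "0 < u" "u < t"
    have "(E has_real_derivative - inner (V u) (A u) - 3 / u * (norm (V u))\<^sup>2
        + 2 * inner (V u) (A u) / 2) (at u)"
      unfolding E_def using u
      by (intro DERIV_add DERIV_cdivide f_X_deriv speed_deriv) auto
    then show "\<exists>y. (E has_real_derivative y) (at u) \<and> y \<le> 0"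
      using u by - (rule exI, rule conjI, assumption, simp add: add_nonneg_nonneg)
  next
    have "continuous_on {0..} E"
      unfolding E_def by (intro continuous_intros f_X_cont V_cont) simp
    then show "continuous_on {0..t} E"
      by (rule continuous_on_subset) auto
  qed
  then have "(norm (V t))\<^sup>2 \<le> 2 * (f z - f xs)"
    using f_min[OF X_in[OF assms]] by (simp add: E_def X_0 V_0)
  also have "\<dots> \<le> g\<^sup>2 / \<mu>"
    using gap_le_norm_grad[OF z_in] by (simp add: g_def)
  also have "\<dots> = (g / sqrt \<mu>)\<^sup>2"
    using mu_pos by (simp only: power_divide real_sqrt_pow2 less_imp_le)
  finally show ?thesis
    by (rule power2_le_imp_le) (use g_pos mu_pos in simp)
qed

lemma grad_drift:
  assumes "t > 0"
  shows "norm (grad (X t) - grad z) \<le> a * g * t"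
proof -
  have "norm (X t - X 0) \<le> g / sqrt \<mu> * t - g / sqrt \<mu> * 0"
  proof (rule differentiable_bound_general[OF assms])
    show "continuous_on {0..t} X"
      using X_cont by (rule continuous_on_subset) auto
    show "(X has_vector_derivative V u) (at u)" if "0 < u" for u
      by (rule X_deriv[OF that])
    show "((\<lambda>t. g / sqrt \<mu> * t) has_vector_derivative g / sqrt \<mu>) (at u)" for u
      unfolding has_real_derivative_iff_has_vector_derivative[symmetric] by (rule DERIV_cmult_Id)
    show "norm (V u) \<le> g / sqrt \<mu>" if "0 < u" for u
      using that by (intro velocity_bound) simp
    show "continuous_on {0..t} (\<lambda>t. g / sqrt \<mu> * t)"
      by (intro continuous_intros)
  qed
  then have "L * norm (X t - z) \<le> L * (g / sqrt \<mu> * t)"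
    using L_pos by (intro mult_left_mono) (simp_all add: X_0)
  then show ?thesis
    using grad_lipschitz[OF X_in z_in, of t] assms by (simp add: a_def mult_ac)
qed

text \<open>The equation says that \<open>t\<^sup>3 V(t)\<close> has derivative \<open>- t\<^sup>3 \<nabla>f(X(t))\<close>.\<close>

lemma velocity_expansion:
  assumes "t > 0"
  shows "norm (V t + (t / 4) *\<^sub>R grad z) \<le> a * g * t\<^sup>2 / 5"
proof -
  \<comment> \<open>The second summand turns \<open>grad (X u)\<close> in the derivative into the
    difference \<open>grad (X u) - grad z\<close>, which \<open>grad_drift\<close> controls.\<close>
  define W where "W u = u ^ 3 *\<^sub>R V u + (u ^ 4 / 4) *\<^sub>R grad z" for u
  have "norm (W t - W 0) \<le> a * g * t ^ 5 / 5 - a * g * 0 ^ 5 / 5"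
  proof (rule differentiable_bound_general[OF assms])
    have "continuous_on {0..} W"
      unfolding W_def by (intro continuous_intros V_cont) simp
    then show "continuous_on {0..t} W"
      by (rule continuous_on_subset) auto
    show "(W has_vector_derivative - (u ^ 3 *\<^sub>R (grad (X u) - grad z))) (at u)"
      if u: "0 < u" for u
    proof -
      have "(W has_vector_derivative
          u ^ 3 *\<^sub>R A u + (3 * u\<^sup>2) *\<^sub>R V u + u ^ 3 *\<^sub>R grad z) (at u)"
        unfolding W_def
        by (auto intro!: derivative_eq_intros V_deriv u)
      moreover have "u ^ 3 *\<^sub>R A u = - (3 * u\<^sup>2) *\<^sub>R V u - u ^ 3 *\<^sub>R grad (X u)"
        using u by (simp add: A_eq scaleR_diff_right power2_eq_square power3_eq_cube)
      ultimately show ?thesis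
        by (simp add: scaleR_diff_right)
    qed
    show "((\<lambda>u. a * g * u ^ 5 / 5) has_vector_derivative a * g * u ^ 4) (at u)" for u
      by (auto intro!: derivative_eq_intros
          simp: has_real_derivative_iff_has_vector_derivative[symmetric])
    show "norm (- (u ^ 3 *\<^sub>R (grad (X u) - grad z))) \<le> a * g * u ^ 4" if u: "0 < u" for u
      using mult_left_mono[OF grad_drift[OF u], of "u ^ 3"] u
      by (simp add: power_numeral_reduce mult_ac)
  qed (auto intro!: continuous_intros)
  moreover have "W t - W 0 = t ^ 3 *\<^sub>R (V t + (t / 4) *\<^sub>R grad z)"
    by (simp add: W_def scaleR_add_right power_numeral_reduce)
  ultimately have "t ^ 3 * norm (V t + (t / 4) *\<^sub>R grad z) \<le> t ^ 3 * (a * g * t\<^sup>2 / 5)"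
    using assms by (simp add: power_numeral_reduce mult_ac)
  then show ?thesis
    using assms by simp
qed

text \<open>The main term \<open>- (t / 4) *\<^sub>R grad z\<close> has norm
  \<open>t * g / 4\<close>, and for \<open>t \<le> t0\<close> the error in
  \<open>velocity_expansion\<close> is at most \<open>t * g / 50\<close>.\<close>

lemma speed_lower_bound:
  assumes "0 < t" "t \<le> t0"
  shows "norm (V t) \<ge> t * g / 8"
proof -
  have "a * t \<le> 1 / 10"
    using assms a_pos by (simp add: t0_def field_simps)
  then have "a * t * (t * g) \<le> 1 / 10 * (t * g)"
    using assms g_pos by (intro mult_right_mono) auto
  then have "norm (V t + (t / 4) *\<^sub>R grad z) \<le> t * g / 50"
    using velocity_expansion[OF assms(1)] by (simp add: power2_eq_square mult_ac)
  moreover have "norm ((t / 4) *\<^sub>R grad z) = t * g / 4"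
    using assms by (simp add: g_def)
  moreover have "norm ((t / 4) *\<^sub>R grad z) \<le> norm (V t + (t / 4) *\<^sub>R grad z) + norm (V t)"
    using norm_triangle_ineq4[of "V t + (t / 4) *\<^sub>R grad z" "V t"] by simp
  moreover have "0 < t * g"
    using assms g_pos by simp
  ultimately show ?thesis by linarith
qed

text \<open>To leading order \<open>V t\<close> is \<open>- (t / 4) *\<^sub>R grad z\<close> and
  \<open>A t\<close> is \<open>- (1 / 4) *\<^sub>R grad z\<close>, with inner product
  \<open>t * g\<^sup>2 / 16\<close>. The choice of \<open>t0\<close> keeps the terms with the errors
  \<open>E\<close> and \<open>F\<close> below this.\<close>

lemma speed_increasing:
  assumes "0 < t" "t \<le> t0"
  shows "inner (V t) (A t) > 0"
proof -
  define E where "E = V t + (t / 4) *\<^sub>R grad z"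
  define D where "D = grad (X t) - grad z"
  define F where "F = (3 / t) *\<^sub>R E + D"
  define s where "s = a * t"
  have s: "0 \<le> s" "s \<le> 1 / 10"
    using assms a_pos by (simp_all add: s_def t0_def field_simps)
  have E: "norm E \<le> s / 5 * (t * g)"
    using velocity_expansion[OF assms(1)] by (simp add: E_def s_def power2_eq_square mult_ac)
  have "norm F \<le> 3 / t * norm E + norm D"
    unfolding F_def using norm_triangle_ineq[of "(3 / t) *\<^sub>R E" D] assms by simp
  also have "\<dots> \<le> 3 / t * (s / 5 * (t * g)) + s * g"
    using E grad_drift[OF assms(1)] assms
    by (intro add_mono mult_left_mono) (simp_all add: D_def s_def mult_ac)
  also have "\<dots> = 8 / 5 * s * g"
    using assms by simp
  finally have F: "norm F \<le> 8 / 5 * s * g" .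
  have V: "V t = E - (t / 4) *\<^sub>R grad z"
    by (simp add: E_def)
  have A: "A t = - (1 / 4) *\<^sub>R grad z - F"
    using assms
    by (simp add: A_eq F_def D_def E_def algebra_simps scaleR_left.add[symmetric]
        flip: scaleR_add_left)
  have "inner (V t) (A t)
      = t / 16 * g\<^sup>2 + t / 4 * inner (grad z) F - 1 / 4 * inner E (grad z) - inner E F"
    unfolding V A
    by (simp add: inner_diff_left inner_diff_right inner_add_left inner_add_right g_def
        power2_norm_eq_inner algebra_simps)
  moreover have "t / 4 * inner (grad z) F \<ge> - (t / 4 * (g * (8 / 5 * s * g)))"
  proof -
    have "- inner (grad z) F \<le> g * norm F"
      using norm_cauchy_schwarz[of "- grad z" F] by (simp add: g_def)
    also have "\<dots> \<le> g * (8 / 5 * s * g)"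
      using F g_pos by (intro mult_left_mono) auto
    finally have "t / 4 * (- inner (grad z) F) \<le> t / 4 * (g * (8 / 5 * s * g))"
      using assms by (intro mult_left_mono) auto
    then show ?thesis by simp
  qed
  moreover have "inner E (grad z) \<le> s / 5 * (t * g) * g"
    using norm_cauchy_schwarz[of E "grad z"] mult_right_mono[OF E, of g] g_pos
    unfolding g_def by linarith
  moreover have "inner E F \<le> s / 5 * (t * g) * (8 / 5 * s * g)"
    using norm_cauchy_schwarz[of E F] mult_mono[OF E F] s assms g_pos by simp
  \<comment> \<open>The coefficient 9/20 collects 2/5 from the term with \<open>grad z\<close> and
    \<open>F\<close> and 1/20 from the one with \<open>E\<close> and \<open>grad z\<close>; 8/25
    comes from \<open>inner E F\<close>. The bracket decreases in \<open>s\<close> and is still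
    about 0.014 at \<open>s = 1 / 10\<close>.\<close>
  ultimately have "inner (V t) (A t) \<ge> t * g\<^sup>2 * (1 / 16 - 9 / 20 * s - 8 / 25 * (s * s))"
    by (simp add: algebra_simps power2_eq_square)
  moreover have "s * s \<le> 1 / 10 * (1 / 10)"
    using s by (intro mult_mono) auto
  then have "0 < 1 / 16 - 9 / 20 * s - 8 / 25 * (s * s)"
    using s by linarith
  then have "0 < t * g\<^sup>2 * (1 / 16 - 9 / 20 * s - 8 / 25 * (s * s))"
    using assms g_pos by simp
  ultimately show ?thesis by linarith
qed

definition S :: "real set" where
  "S = {t. t > 0 \<and> (\<forall>u\<in>{0<..<t}. inner (V u) (A u) > 0)}"

text \<open>The two-sided vector derivative of \<open>X\<close> is identified with \<open>V\<close>
  only at positive times, hence the transfer of \<open>speed_deriv\<close> on the open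
  half-line.\<close>

lemma restart_time_eq: "restart_time X = Sup S"
proof -
  have "deriv (\<lambda>s. (norm (vector_derivative X (at s)))\<^sup>2) u = 2 * inner (V u) (A u)"
    if u: "u > 0" for u
  proof (rule DERIV_imp_deriv)
    show "((\<lambda>s. (norm (vector_derivative X (at s)))\<^sup>2) has_real_derivative
        2 * inner (V u) (A u)) (at u)"
      by (rule has_field_derivative_transform_within_open[OF speed_deriv[OF u], of "{0<..}"])
        (use u X_deriv in \<open>auto simp: vector_derivative_at[OF X_deriv]\<close>)
  qed
  then have "S = {t. t > 0 \<and>
      (\<forall>u\<in>{0<..<t}. deriv (\<lambda>s. (norm (vector_derivative X (at s)))\<^sup>2) u > 0)}"
    by (auto simp: S_def)
  then show ?thesis by (simp add: restart_time_def)
qed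

lemma t0_mem_S: "t0 \<in> S"
  using speed_increasing t0_pos by (auto simp: S_def)

lemma S_le_T_max:
  assumes t: "t \<in> S"
  shows "t \<le> T_max"
proof (cases "t \<le> t0")
  case True
  also have "t0 * 1 \<le> T_max"
    unfolding T_max_def using t0_pos by (intro mult_left_mono) simp_all
  finally show ?thesis by simp
next
  case False
  \<comment> \<open>A lower bound for the squared speed at \<open>t0\<close>, which persists up to
    \<open>t\<close> because the speed increases.\<close>
  define c where "c = (t0 * g / 8)\<^sup>2"
  have c: "c > 0" using t0_pos g_pos by (simp add: c_def)
  have speed: "c \<le> (norm (V u))\<^sup>2" if u: "t0 < u" "u < t" for u
  proof -
    have "c \<le> (norm (V t0))\<^sup>2"
      unfolding c_def using speed_lower_bound[of t0] t0_pos g_pos by (intro power_mono) auto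
    also have "\<dots> \<le> (norm (V u))\<^sup>2"
    proof (rule DERIV_nonneg_imp_nondecreasing[of t0 u])
      show "\<exists>y. ((\<lambda>u. (norm (V u))\<^sup>2) has_real_derivative y) (at v) \<and> 0 \<le> y"
        if "t0 \<le> v" "v \<le> u" for v
      proof (intro exI conjI)
        show "((\<lambda>u. (norm (V u))\<^sup>2) has_real_derivative 2 * inner (V v) (A v)) (at v)"
          by (rule speed_deriv) (use that t0_pos in simp)
        show "0 \<le> 2 * inner (V v) (A v)"
          using t that u t0_pos by (auto simp: S_def intro!: less_imp_le)
      qed
    qed (use u in simp)
    finally show ?thesis .
  qed
  \<comment> \<open>Since \<open>f (X u)\<close> has derivative at most \<open>- 3 * c / u\<close>,
    adding \<open>3 * c * ln u\<close> still leaves a nonincreasing function.\<close>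
  define h where "h u = f (X u) + 3 * c * ln u" for u
  have "h t \<le> h t0"
  proof (rule DERIV_nonpos_imp_decreasing_open[of t0 t])
    fix u assume u: "t0 < u" "u < t"
    then have "u > 0" using t0_pos by simp
    have "(h has_real_derivative - inner (V u) (A u) - 3 / u * (norm (V u))\<^sup>2
        + 3 * c * (1 / u)) (at u)"
      unfolding h_def using \<open>u > 0\<close>
      by (intro DERIV_add DERIV_cmult f_X_deriv) (auto intro!: derivative_eq_intros)
    moreover have "0 < inner (V u) (A u)"
      using t u \<open>u > 0\<close> by (auto simp: S_def)
    moreover have "3 / u * c \<le> 3 / u * (norm (V u))\<^sup>2"
      using speed[OF u] \<open>u > 0\<close> by (intro mult_left_mono) auto
    ultimately show "\<exists>y. (h has_real_derivative y) (at u) \<and> y \<le> 0"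
      by - (rule exI, rule conjI, assumption, simp add: add_nonneg_nonneg)
  next
    show "continuous_on {t0..t} h"
      unfolding h_def using t0_pos
      by (intro continuous_intros continuous_on_subset[OF f_X_cont]) auto
  qed (use False in simp)
  moreover have "f (X t0) \<le> f z"
    using f_X_antimono[of 0 t0] speed_increasing t0_pos by (simp add: X_0)
  moreover have "f xs \<le> f (X t)"
    using t by (intro f_min X_in) (simp add: S_def)
  moreover have "f z - f xs \<le> g\<^sup>2 / (2 * \<mu>)"
    using gap_le_norm_grad[OF z_in] by (simp add: g_def)
  ultimately have "3 * c * (ln t - ln t0) \<le> g\<^sup>2 / (2 * \<mu>)"
    by (simp add: h_def algebra_simps)
  also have "g\<^sup>2 / (2 * \<mu>) = 3 * c * (3200 / 3 * (L / \<mu>)\<^sup>2)"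
    using mu_pos L_pos
    by (simp add: c_def t0_def a_def power_divide power_mult_distrib field_simps)
      (simp add: power2_eq_square)
  finally have "ln t - ln t0 \<le> 3200 / 3 * (L / \<mu>)\<^sup>2"
    using c by simp
  moreover have "ln T_max = ln t0 + 3200 / 3 * (L / \<mu>)\<^sup>2"
    unfolding T_max_def using t0_pos by (simp add: ln_mult)
  moreover have "T_max > 0"
    using t0_pos by (simp add: T_max_def)
  moreover have "t > 0"
    using t by (simp add: S_def)
  ultimately show ?thesis
    using ln_le_cancel_iff[of t T_max] by simp
qed

text \<open>The set \<open>S\<close> contains \<open>t0\<close> and is bounded by
  \<open>T_max\<close>, so its real \<open>Sup\<close> is a genuine least upper bound.\<close>

lemma restart_time_bounds: "t0 \<le> restart_time X" "restart_time X \<le> T_max"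
proof -
  have "bdd_above S"
    using S_le_T_max by (rule bdd_aboveI)
  then show "t0 \<le> restart_time X" "restart_time X \<le> T_max"
    unfolding restart_time_eq using t0_mem_S S_le_T_max
    by (auto intro: cSup_upper cSup_least)
qed

lemma speed_increasing_run:
  assumes "0 < u" "u < restart_time X"
  shows "inner (V u) (A u) > 0"
proof -
  obtain t where "t \<in> S" "u < t"
    using assms(2) t0_mem_S unfolding restart_time_eq
    by (metis less_cSupD empty_iff)
  then show ?thesis
    using assms(1) by (auto simp: S_def)
qed

text \<open>The gain comes from the time up to \<open>t0\<close>; from there to the restart
  \<open>f\<close> does not increase. The Polyak-Lojasiewicz inequality turns a gain proportional to
  \<open>g\<^sup>2\<close> into a fraction of the gap.\<close>

lemma run_decrease:
  "f (X (restart_time X)) - f xs \<le> (1 - 3 / 6400 * (\<mu> / L)\<^sup>2) * (f z - f xs)"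
proof -
  \<comment> \<open>Chosen so that \<open>c * (2 * u)\<close> equals
    \<open>3 / u * (u * g / 8)\<^sup>2\<close>, the guaranteed rate of decrease before
    \<open>t0\<close>.\<close>
  define c where "c = 3 / 128 * g\<^sup>2"
  have "f (X t0) + c * t0\<^sup>2 \<le> f (X 0) + c * 0\<^sup>2"
  proof (rule DERIV_nonpos_imp_decreasing_open[of 0 t0])
    fix u assume u: "0 < u" "u < t0"
    have "((\<lambda>u. f (X u) + c * u\<^sup>2) has_real_derivative
        - inner (V u) (A u) - 3 / u * (norm (V u))\<^sup>2 + c * (2 * u)) (at u)"
      using u by (intro DERIV_add DERIV_cmult f_X_deriv) (auto intro!: derivative_eq_intros)
    moreover have "c * (2 * u) \<le> 3 / u * (norm (V u))\<^sup>2"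
    proof -
      have "(u * g / 8)\<^sup>2 \<le> (norm (V u))\<^sup>2"
        using speed_lower_bound[of u] u g_pos by (intro power_mono) auto
      then have "3 / u * (u * g / 8)\<^sup>2 \<le> 3 / u * (norm (V u))\<^sup>2"
        using u by (intro mult_left_mono) auto
      also have "3 / u * (u * g / 8)\<^sup>2 = c * (2 * u)"
        using u by (simp add: c_def field_simps power2_eq_square)
      finally show ?thesis .
    qed
    ultimately show "\<exists>y. ((\<lambda>u. f (X u) + c * u\<^sup>2) has_real_derivative y) (at u) \<and> y \<le> 0"
      using speed_increasing[of u] u by - (rule exI, rule conjI, assumption, simp add: add_nonneg_nonneg)
  next
    show "continuous_on {0..t0} (\<lambda>u. f (X u) + c * u\<^sup>2)"
      by (intro continuous_intros continuous_on_subset[OF f_X_cont]) auto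
  qed (use t0_pos in simp)
  moreover have "f (X (restart_time X)) \<le> f (X t0)"
    using restart_time_bounds t0_pos by (intro f_X_antimono speed_increasing_run) auto
  moreover have "3 / 6400 * (\<mu> / L)\<^sup>2 * (f z - f xs) \<le> 3 / 6400 * (\<mu> / L)\<^sup>2 * (g\<^sup>2 / (2 * \<mu>))"
    using gap_le_norm_grad[OF z_in] by (intro mult_left_mono) (simp_all add: g_def)
  moreover have "3 / 6400 * (\<mu> / L)\<^sup>2 * (g\<^sup>2 / (2 * \<mu>)) = c * t0\<^sup>2"
    using mu_pos L_pos
    by (simp add: c_def t0_def a_def power_divide power_mult_distrib field_simps)
      (simp add: power2_eq_square)
  ultimately have "f (X (restart_time X)) \<le> f z - 3 / 6400 * (\<mu> / L)\<^sup>2 * (f z - f xs)"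
    by (simp add: X_0)
  then show ?thesis
    by (simp add: left_diff_distrib)
qed

end

section \<open>Iteration over the runs\<close>

context strongly_convex_smooth
begin

lemma restart_estimates:
  assumes "z \<noteq> xs" and ode: "ode_solution n f z Y"
  shows "t0 \<le> restart_time Y" "restart_time Y \<le> T_max"
    "\<And>t. 0 \<le> t \<Longrightarrow> t \<le> restart_time Y \<Longrightarrow> f (Y t) \<le> f z"
    "f (Y (restart_time Y)) - f xs \<le> (1 - 3 / 6400 * (\<mu> / L)\<^sup>2) * (f z - f xs)"
proof -
  obtain V A where "restarted_run n \<mu> L f xs z Y V A"
    using assms strongly_convex_smooth_axioms
    unfolding ode_solution_def restarted_run_def restarted_run_axioms_def by auto
  then interpret restarted_run n \<mu> L f xs z Y V A .
  show "t0 \<le> restart_time Y" "restart_time Y \<le> T_max"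
    by (rule restart_time_bounds)+
  show "f (Y t) \<le> f z" if "0 \<le> t" "t \<le> restart_time Y" for t
    using f_X_antimono[of 0 t] speed_increasing_run that by (simp add: X_0)
  show "f (Y (restart_time Y)) - f xs \<le> (1 - 3 / 6400 * (\<mu> / L)\<^sup>2) * (f z - f xs)"
    by (rule run_decrease)
qed

text \<open>Each run takes at most \<open>T_max\<close> and multiplies the gap by at most
  \<open>1 - q \<le> exp (- q)\<close>. The factor \<open>exp q\<close> pays for the run in progress
  at time \<open>t\<close>, where only the bound by the value at its start is used.\<close>

lemma speed_restarted_rate:
  fixes q :: real
  defines "q \<equiv> 3 / 6400 * (\<mu> / L)\<^sup>2"
  assumes x0: "x0 \<in> Rn n" and sr: "speed_restarted n f xs x0 X" and t: "t \<ge> 0"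
  shows "f (X t) - f xs \<le> exp q * exp (- q * t / T_max) * (f x0 - f xs)"
proof -
  obtain T where T: "\<forall>i. let \<tau> = (\<Sum>j=1..i. T j) in
        if X \<tau> = xs then T (Suc i) = 0 \<and> (\<forall>t\<ge>\<tau>. X t = xs)
        else \<exists>Y. ode_solution n f (X \<tau>) Y \<and> T (Suc i) = restart_time Y \<and>
                 (\<forall>t\<in>{0..T (Suc i)}. X (\<tau> + t) = Y t)"
    using sr unfolding speed_restarted_def by blast
  define \<tau> where "\<tau> i = (\<Sum>j=1..i. T j)" for i :: nat
  have step: "if X (\<tau> i) = xs then T (Suc i) = 0 \<and> (\<forall>t\<ge>\<tau> i. X t = xs)
        else \<exists>Y. ode_solution n f (X (\<tau> i)) Y \<and> T (Suc i) = restart_time Y \<and>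
                 (\<forall>t\<in>{0..T (Suc i)}. X (\<tau> i + t) = Y t)" for i
    using T[rule_format, of i] unfolding Let_def \<tau>_def .
  have X_0: "X 0 = x0"
    using sr by (simp add: speed_restarted_def)
  have \<tau>_0: "\<tau> 0 = 0" and \<tau>_Suc: "\<tau> (Suc i) = \<tau> i + T (Suc i)" for i
    by (simp_all add: \<tau>_def)
  have at_min: "T (Suc i) = 0" "\<And>t. t \<ge> \<tau> i \<Longrightarrow> X t = xs" if "X (\<tau> i) = xs" for i
    using step[of i] unfolding if_P[OF that] by blast+
  have run: "t0 \<le> T (Suc i) \<and> T (Suc i) \<le> T_max \<and>
      (\<forall>t\<in>{\<tau> i..\<tau> (Suc i)}. f (X t) \<le> f (X (\<tau> i))) \<and>
      f (X (\<tau> (Suc i))) - f xs \<le> (1 - q) * (f (X (\<tau> i)) - f xs)"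
    if ne: "X (\<tau> i) \<noteq> xs" for i
  proof -
    obtain Y where Y: "ode_solution n f (X (\<tau> i)) Y" "T (Suc i) = restart_time Y"
      and XY: "\<And>t. t \<in> {0..T (Suc i)} \<Longrightarrow> X (\<tau> i + t) = Y t"
      using step[of i] unfolding if_not_P[OF ne] by blast
    note est = restart_estimates[OF ne Y(1), folded Y(2)]
    have "f (X t) \<le> f (X (\<tau> i))" if "t \<in> {\<tau> i..\<tau> (Suc i)}" for t
      using that est(3)[of "t - \<tau> i"] XY[of "t - \<tau> i"] by (simp add: \<tau>_Suc)
    moreover have "X (\<tau> (Suc i)) = Y (T (Suc i))"
      using XY[of "T (Suc i)"] est(1) t0_pos by (simp add: \<tau>_Suc)
    ultimately show ?thesis
      using est by (simp add: q_def)
  qed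
  have "\<mu> / L \<le> 1"
    using mu_le_L L_pos by simp
  then have "(\<mu> / L)\<^sup>2 \<le> 1"
    using mu_pos L_pos by (simp add: power_le_one)
  then have q: "0 \<le> q" "q \<le> 1"
    by (simp_all add: q_def)
  have decay: "f (X (\<tau> i)) - f xs \<le> exp (- q * i) * (f x0 - f xs)" for i
  proof (induction i)
    case 0
    show ?case by (simp add: \<tau>_0 X_0)
  next
    case (Suc i)
    show ?case
    proof (cases "X (\<tau> i) = xs")
      \<comment> \<open>By the convention \<open>T (Suc i) = 0\<close> the next restart point is
        again \<open>xs\<close>, where the gap is 0.\<close>
      case True
      then have "X (\<tau> (Suc i)) = xs"
        by (simp add: \<tau>_Suc at_min)
      then show ?thesis using f_min[OF x0] by simp
    next
      case False
      then have "f (X (\<tau> (Suc i))) - f xs \<le> (1 - q) * (f (X (\<tau> i)) - f xs)"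
        using run by blast
      also have "\<dots> \<le> (1 - q) * (exp (- q * i) * (f x0 - f xs))"
        using Suc q by (intro mult_left_mono) auto
      also have "\<dots> \<le> exp (- q) * (exp (- q * i) * (f x0 - f xs))"
        using exp_ge_add_one_self[of "- q"] f_min[OF x0] by (intro mult_right_mono) auto
      also have "\<dots> = exp (- q + - q * i) * (f x0 - f xs)"
        by (simp only: exp_add mult.assoc)
      also have "- q + - q * i = - q * Suc i"
        by (simp add: algebra_simps)
      finally show ?thesis .
    qed
  qed
  have \<tau>_le: "\<tau> i \<le> i * T_max" for i
  proof (induction i)
    case (Suc i)
    moreover have "T (Suc i) \<le> T_max"
      using at_min(1)[of i] run[of i] T_max_pos by (cases "X (\<tau> i) = xs") auto
    ultimately show ?case by (simp add: \<tau>_Suc algebra_simps)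
  qed (simp add: \<tau>_0)
  \<comment> \<open>Either the process rests from \<open>\<tau> i\<close> on, or \<open>t\<close>
    lies before the end of the run that starts there.\<close>
  define P where "P i \<longleftrightarrow> X (\<tau> i) = xs \<or> t < \<tau> (Suc i)" for i
  have "\<exists>i. P i"
  proof (rule ccontr)
    \<comment> \<open>Every run would last at least \<open>t0\<close>, so the restart times would be
      unbounded, yet none would exceed \<open>t\<close>: restarts cannot accumulate.\<close>
    assume never: "\<not> (\<exists>i. P i)"
    have "i * t0 \<le> \<tau> i" for i
    proof (induction i)
      case (Suc i)
      then show ?case using run[of i] never by (simp add: P_def \<tau>_Suc algebra_simps)
    qed (simp add: \<tau>_0)
    moreover obtain i :: nat where "t < i * t0"
      using reals_Archimedean3[OF t0_pos] by blast
    moreover have "\<tau> (Suc j) \<le> t" for j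
      using never by (simp add: P_def not_less)
    then have "\<tau> i \<le> t"
      using t by (cases i) (simp_all add: \<tau>_0)
    ultimately show False by (meson not_less order_trans)
  qed
  then obtain k where k: "P k" "\<And>i. i < k \<Longrightarrow> \<not> P i"
    by (metis LeastI not_less_Least)
  \<comment> \<open>For positive \<open>k\<close> this is the failure of \<open>P\<close> at
    \<open>k - 1\<close>; for \<open>k = 0\<close> it is \<open>t \<ge> 0\<close>.\<close>
  have \<tau>_k: "\<tau> k \<le> t"
    using t k(2)[of "k - 1"] by (cases k) (auto simp: \<tau>_0 P_def)
  show ?thesis
  proof (cases "X (\<tau> k) = xs")
    case True
    then show ?thesis
      using at_min(2)[OF True \<tau>_k] f_min[OF x0] by simp
  next
    case False
    then have t_k: "t < \<tau> (Suc k)"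
      using k(1) by (simp add: P_def)
    then have "t \<le> Suc k * T_max"
      using \<tau>_le[of "Suc k"] by simp
    then have "t / T_max \<le> Suc k"
      using T_max_pos by (simp add: pos_divide_le_eq)
    then have "q * (t / T_max) \<le> q * Suc k"
      using q by (intro mult_left_mono) auto
    then have exp_le: "exp (- q * k) \<le> exp (q + - q * t / T_max)"
      by (simp add: algebra_simps)
    have "f (X t) - f xs \<le> f (X (\<tau> k)) - f xs"
      using run[OF False] \<tau>_k t_k by simp
    also have "\<dots> \<le> exp (- q * k) * (f x0 - f xs)"
      by (rule decay)
    also have "\<dots> \<le> exp (q + - q * t / T_max) * (f x0 - f xs)"
      using exp_le f_min[OF x0] by (intro mult_right_mono) auto
    finally show ?thesis by (simp only: exp_add)
  qed
qed

end

section \<open>Choice of constants in terms of \<kappa>\<close>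

theorem theorem10:
  fixes \<kappa> :: real
  assumes "\<kappa> \<ge> 1"
  shows "\<exists>c1 c2 :: real. c1 > 0 \<and> c2 > 0 \<and>
    (\<forall>(n :: nat) (\<mu> :: real) (L :: real) (f :: fseq \<Rightarrow> real) (xs :: fseq) (x0 :: fseq)
        (X :: real \<Rightarrow> fseq) (t :: real).
       0 < \<mu> \<longrightarrow> \<mu> \<le> L \<longrightarrow> L / \<mu> = \<kappa> \<longrightarrow>
       f \<in> S_class n \<mu> L \<longrightarrow>
       is_arg_min f (\<lambda>x. x \<in> Rn n) xs \<longrightarrow>
       x0 \<in> Rn n \<longrightarrow>
       speed_restarted n f xs x0 X \<longrightarrow>
       t \<ge> 0 \<longrightarrow>
       f (X t) - f xs \<le> c1 * L * (norm (x0 - xs))\<^sup>2 / 2 * exp (- c2 * t * sqrt L))"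
proof -
  define q where "q = 3 / 6400 * (1 / \<kappa>)\<^sup>2"
  \<comment> \<open>This is \<open>q / (T_max * sqrt L)\<close>: since \<open>L / \<mu>\<close>
    equals \<kappa>, \<open>T_max\<close> is a function of \<kappa> divided by
    \<open>sqrt L\<close>.\<close>
  define c2 where "c2 = q * (10 * sqrt \<kappa> / exp (3200 / 3 * \<kappa>\<^sup>2))"
  \<comment> \<open>The factor 2 cancels the division by 2 in the claim, since
    \<open>gap_le_dist\<close> has the constant \<open>L\<close>.\<close>
  have bound: "f (X t) - f xs \<le> 2 * exp q * L * (norm (x0 - xs))\<^sup>2 / 2 * exp (- c2 * t * sqrt L)"
    if mu: "0 < \<mu>" "\<mu> \<le> L" and kappa: "L / \<mu> = \<kappa>"
      and f: "f \<in> S_class n \<mu> L" "is_arg_min f (\<lambda>x. x \<in> Rn n) xs"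
      and x0: "x0 \<in> Rn n" and X: "speed_restarted n f xs x0 X" and t: "t \<ge> 0"
    for n \<mu> L f xs x0 X t
  proof -
    interpret strongly_convex_smooth n \<mu> L f xs
      using mu f by unfold_locales
    have q: "q = 3 / 6400 * (\<mu> / L)\<^sup>2"
      using kappa[symmetric] by (simp add: q_def)
    have "sqrt \<mu> / L = 1 / (sqrt \<kappa> * sqrt L)"
    proof -
      have "sqrt \<kappa> * sqrt L = L / sqrt \<mu>"
        using kappa[symmetric] L_pos by (simp add: real_sqrt_divide)
      then show ?thesis by simp
    qed
    moreover have "T_max = sqrt \<mu> / L * (exp (3200 / 3 * \<kappa>\<^sup>2) / 10)"
      by (simp add: T_max_def t0_def a_def kappa mult_ac)
    ultimately have "T_max = exp (3200 / 3 * \<kappa>\<^sup>2) / (10 * sqrt \<kappa> * sqrt L)"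
      by simp
    then have "c2 * t * sqrt L = q * t / T_max"
      by (simp add: c2_def mult_ac)
    then have "f (X t) - f xs \<le> exp q * exp (- c2 * t * sqrt L) * (f x0 - f xs)"
      using speed_restarted_rate[OF x0 X t, folded q] by simp
    also have "\<dots> \<le> exp q * exp (- c2 * t * sqrt L) * (L * (norm (x0 - xs))\<^sup>2)"
      using gap_le_dist[OF x0] by (intro mult_left_mono) auto
    finally show ?thesis by (simp add: mult_ac)
  qed
  have "c2 > 0"
    using assms by (simp add: c2_def q_def)
  show ?thesis
    apply (rule exI[of _ "2 * exp q"], rule exI[of _ c2], intro conjI allI impI)
      apply simp
     apply (rule \<open>c2 > 0\<close>)
    subgoal for n \<mu> L f xs x0 X t
      by (rule bound[of \<mu> L f n xs x0 X t])
    done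
qed

end
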